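(* Let $H(\gamma)$ be any arbitrary performance metric depending on the instantaneous SNR $\gamma$, and let $0\le a<b\le\infty$. For $g>0$ and $K\ge0$ let $$\overline{H}_R(g,K)=\int_a^b H(y)\,f_{Rice}(y;K,g)\,dy$$ be this performance metric in Rician fading with average SNR $g$ and Rician parameter $K$, obtained by averaging over an interval of the PDF of the SNR. Let $\bar\gamma>0$ and let $\alpha\ge0$, $\beta\ge0$ with $\alpha+\beta\le1$, and let $$\overline{H}_S(\bar\gamma;\alpha,\beta)=\int_a^b H(y)\,f_\gamma(y;\alpha,\beta)\,dy$$ be the performance metric in the SOSF channel with average SNR $\bar\gamma$ and shape parameters $\alpha,\beta$, where $f_\gamma(\cdot\,;\alpha,\beta)$ is the PDF of the SNR of that channel. Then $$\overline{H}_S(\bar\gamma;\alpha,\beta)=\int_0^\infty \overline{H}_R(\bar\gamma_x,K_x)\,e^{-x}\,dx,\qquad \bar\gamma_x=\bar\gamma(1-\alpha(1-x)),\quad K_x=\frac{\beta}{1-\beta-\alpha(1-x)} .$$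
   Context: SOSF (second order scattering fading) channel: $S=\omega_0e^{j\phi}+\omega_1G_1+\omega_2G_2G_3$, where $j$ is the imaginary unit, $\omega_0,\omega_1,\omega_2\ge 0$ are real constants with $\omega_0^2+\omega_1^2+\omega_2^2=1$, $\phi$ is uniform on $[0,2\pi)$, and $G_1,G_2,G_3$ are circularly-symmetric complex Gaussian random variables with mean $0$ and variance $\mathbb{E}|G_i|^2=1$; $\phi,G_1,G_2,G_3$ are mutually independent. The parameters are $\alpha=\omega_2^2$ and $\beta=\omega_0^2$ (so $\omega_1^2=1-\alpha-\beta$). The instantaneous SNR is $\gamma=\bar\gamma|S|^2$, so that $\mathbb{E}(\gamma)=\bar\gamma$. The Rician SNR density with factor $K\ge0$ and mean $g>0$ is $$f_{Rice}(y;K,g)=\frac{1+K}{g}\,e^{-K}e^{-\frac{(1+K)y}{g}}\,I_0\!\left(2\sqrt{\frac{K(1+K)y}{g}}\right),\quad y\ge0,$$ with $I_0$ the modified Bessel function of the first kind of order zero. *)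

theory Defs
  imports "HOL-Probability.Probability"
begin

definition bessel_I0 :: "real \<Rightarrow> real" where
  "bessel_I0 z = (\<Sum>k. (z / 2) ^ (2 * k) / (fact k)\<^sup>2)"

definition rice_snr_pdf :: "real \<Rightarrow> real \<Rightarrow> real \<Rightarrow> real" where
  "rice_snr_pdf K g y =
     (if 0 \<le> y
      then (1 + K) / g * exp (- K) * exp (- ((1 + K) * y / g))
             * bessel_I0 (2 * sqrt (K * (1 + K) * y / g))
      else 0)"

text \<open>
  A circularly-symmetric complex Gaussian variable of mean \<open>0\<close> with \<open>E |G|\<^sup>2 = 1\<close>: real and
  imaginary part are independent centred normals, each carrying half of the variance.
  Note that \<^const>\<open>normal_density\<close> takes the standard deviation.
\<close>

definition (in prob_space) std_complex_normal :: "('a \<Rightarrow> complex) \<Rightarrow> bool" where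
  "std_complex_normal G \<longleftrightarrow>
     indep_var borel (\<lambda>w. Re (G w)) borel (\<lambda>w. Im (G w)) \<and>
     distributed M lborel (\<lambda>w. Re (G w)) (normal_density 0 (sqrt (1 / 2))) \<and>
     distributed M lborel (\<lambda>w. Im (G w)) (normal_density 0 (sqrt (1 / 2)))"

text \<open>
  \<^const>\<open>prob_space.indep_vars\<close> wants variables of one common type; the phase is therefore
  embedded into the complex numbers, which does not change the \<open>\<sigma>\<close>-algebra it generates.
\<close>

locale sosf_channel = prob_space M for M :: "'a measure" +
  fixes \<phi> :: "'a \<Rightarrow> real"
    and G1 G2 G3 :: "'a \<Rightarrow> complex"
    and \<omega>0 \<omega>1 \<omega>2 :: real
  assumes weights_nonneg: "0 \<le> \<omega>0" "0 \<le> \<omega>1" "0 \<le> \<omega>2"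
    and weights_normalized: "\<omega>0\<^sup>2 + \<omega>1\<^sup>2 + \<omega>2\<^sup>2 = 1"
    and phase_uniform: "distributed M lborel \<phi> (\<lambda>t. indicator {0..<2 * pi} t / (2 * pi))"
    and complex_normal:
      "std_complex_normal G1" "std_complex_normal G2" "std_complex_normal G3"
    and mutually_indep:
      "indep_vars (\<lambda>_. borel) (\<lambda>i. [\<lambda>w. complex_of_real (\<phi> w), G1, G2, G3] ! i) {..<4}"

definition sosf_signal ::
  "('a \<Rightarrow> real) \<Rightarrow> ('a \<Rightarrow> complex) \<Rightarrow> ('a \<Rightarrow> complex) \<Rightarrow> ('a \<Rightarrow> complex)
     \<Rightarrow> real \<Rightarrow> real \<Rightarrow> real \<Rightarrow> 'a \<Rightarrow> complex" where
  "sosf_signal \<phi> G1 G2 G3 \<omega>0 \<omega>1 \<omega>2 w =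
     of_real \<omega>0 * exp (\<i> * of_real (\<phi> w)) + of_real \<omega>1 * G1 w + of_real \<omega>2 * G2 w * G3 w"

text \<open>
  The metric \<open>H\<close> averaged over \<open>(a, b)\<close> against the density \<open>p\<close>: as a Lebesgue integral, and, for
  nonnegative \<open>H\<close>, as a possibly infinite integral.
\<close>

definition avg_metric ::
  "(real \<Rightarrow> real) \<Rightarrow> ereal \<Rightarrow> ereal \<Rightarrow> (real \<Rightarrow> real) \<Rightarrow> real" where
  "avg_metric H a b p = (LBINT y=a..b. H y * p y)"

definition nn_avg_metric ::
  "(real \<Rightarrow> real) \<Rightarrow> ereal \<Rightarrow> ereal \<Rightarrow> (real \<Rightarrow> real) \<Rightarrow> ennreal" where
  "nn_avg_metric H a b p = (\<integral>\<^sup>+ y \<in> einterval a b. ennreal (H y * p y) \<partial>lborel)"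

text \<open>
  The Rician parameters conditional on \<open>|G3|\<^sup>2 = x\<close>. The denominator of \<open>cond_K\<close> vanishes for
  some \<open>x > 0\<close> only if \<open>\<beta> = 1\<close> (hence \<open>\<alpha> = 0\<close>), where the SNR is constant and has no density.
\<close>

definition cond_snr :: "real \<Rightarrow> real \<Rightarrow> real \<Rightarrow> real" where
  "cond_snr \<gamma>bar \<alpha> x = \<gamma>bar * (1 - \<alpha> * (1 - x))"

definition cond_K :: "real \<Rightarrow> real \<Rightarrow> real \<Rightarrow> real" where
  "cond_K \<alpha> \<beta> x = \<beta> / (1 - \<beta> - \<alpha> * (1 - x))"

end

theory Submission
  imports Defs
begin

text \<open>
  A law on \<open>[0, \<infinity>)\<close> is determined by its Laplace transform at the natural numbers, since these
  are the moments of its image on \<open>[0, 1]\<close> under \<open>x \<mapsto> exp (- x)\<close>.  Integrating out \<open>G1\<close>,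
  then \<open>G2\<close>, by completing squares shows that, conditionally on \<open>G3\<close>, the Laplace transform of
  \<open>|S|\<^sup>2\<close> depends on \<open>|G3|\<^sup>2\<close> only; it is that of a Rician law, read off from the expansion of
  the Rician density as a Poisson mixture of Erlang densities.  As \<open>|G3|\<^sup>2\<close> is exponential, the
  density of the SNR is almost everywhere the exponential mixture of Rician densities, and the
  claim follows by Fubini.
\<close>

section \<open>Uniqueness of laws from moments and from Laplace transforms\<close>

text \<open>On \<open>[0, 1]\<close> the exponential series of \<open>iexp (t * x)\<close> is
  dominated termwise by the series of \<open>exp \<bar>t\<bar>\<close>, so it can be integrated term
  by term. The moments then determine the characteristic function, and with it the law.\<close>

lemma real_distribution_eqI_moments:
  fixes M N :: "real measure"
  assumes M: "real_distribution M" and N: "real_distribution N"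
    and "AE x in M. 0 \<le> x \<and> x \<le> 1" and "AE x in N. 0 \<le> x \<and> x \<le> 1"
    and eq: "\<And>n. (\<integral>\<^sup>+ x. ennreal (x ^ n) \<partial>M) = (\<integral>\<^sup>+ x. ennreal (x ^ n) \<partial>N)"
  shows "M = N"
proof (rule Levy_uniqueness[OF M N], rule ext)
  fix t
  \<comment> \<open>The moments are written as \<open>enn2real\<close> of nonnegative integrals, so
    that the hypothesis \<open>eq\<close> turns one series into the other directly.\<close>
  have char_series: "char L t = (\<Sum>n. (\<i> * of_real t) ^ n / fact n * of_real (enn2real (\<integral>\<^sup>+ x. ennreal (x ^ n) \<partial>L)))"
    if "real_distribution L" and L: "AE x in L. 0 \<le> x \<and> x \<le> 1" for L
  proof -
    interpret L: real_distribution L by fact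
    let ?f = "\<lambda>n x. (\<i> * of_real t) ^ n / fact n * complex_of_real (x ^ n)"
    have int[simp]: "integrable L (\<lambda>x. x ^ n)" for n
    proof (rule L.integrable_const_bound[where B = 1])
      show "AE x in L. norm (x ^ n) \<le> 1"
        using L by eventually_elim (simp add: power_le_one)
    qed simp
    have int_f: "integrable L (?f n)" for n
      by (intro integrable_mult_right integrable_of_real int)
    have exp_series: "iexp (t * x) = (\<Sum>n. ?f n x)" for x
      by (simp add: exp_def scaleR_conv_of_real divide_inverse power_mult_distrib mult_ac)
    have bound: "norm (?f n x) \<le> \<bar>t\<bar> ^ n / fact n" if "0 \<le> x \<and> x \<le> 1" for n x
      using that by (simp add: norm_mult norm_divide norm_power power_le_one mult_left_le divide_right_mono)
    have exp_summable: "summable (\<lambda>n. \<bar>t\<bar> ^ n / fact n)"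
      using summable_exp[of "\<bar>t\<bar>"] by (simp add: divide_inverse mult.commute)
    have "char L t = (\<integral>x. (\<Sum>n. ?f n x) \<partial>L)"
      unfolding char_def exp_series[symmetric] by simp
    also have "\<dots> = (\<Sum>n. \<integral>x. ?f n x \<partial>L)"
    proof (rule integral_suminf)
      show "AE x in L. summable (\<lambda>n. norm (?f n x))"
        using L
      proof eventually_elim
        case (elim x)
        show ?case
          by (rule summable_comparison_test'[OF exp_summable, where N = 0]) (use bound[OF elim] in simp)
      qed
      show "summable (\<lambda>n. \<integral>x. norm (?f n x) \<partial>L)"
      proof (rule summable_comparison_test'[OF exp_summable, where N = 0])
        fix n
        have "(\<integral>x. norm (?f n x) \<partial>L) \<le> (\<integral>x. \<bar>t\<bar> ^ n / fact n \<partial>L)"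
        proof (rule integral_mono_AE[OF integrable_norm[OF int_f]])
          show "AE x in L. norm (?f n x) \<le> \<bar>t\<bar> ^ n / fact n"
            using L by eventually_elim (rule bound)
        qed simp
        then show "norm (\<integral>x. norm (?f n x) \<partial>L) \<le> \<bar>t\<bar> ^ n / fact n"
          using L.prob_space by simp
      qed
    qed (rule int_f)
    also have "(\<lambda>n. \<integral>x. ?f n x \<partial>L) = (\<lambda>n. (\<i> * of_real t) ^ n / fact n * of_real (enn2real (\<integral>\<^sup>+ x. ennreal (x ^ n) \<partial>L)))"
    proof
      fix n
      have "(\<integral>x. ?f n x \<partial>L) = (\<i> * of_real t) ^ n / fact n * of_real (\<integral>x. x ^ n \<partial>L)"
        unfolding integral_mult_right_zero integral_complex_of_real ..
      also have "(\<integral>x. x ^ n \<partial>L) = enn2real (\<integral>\<^sup>+ x. ennreal (x ^ n) \<partial>L)"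
      proof (rule integral_eq_nn_integral)
        show "AE x in L. 0 \<le> x ^ n"
          using L by eventually_elim simp
      qed simp
      finally show "(\<integral>x. ?f n x \<partial>L) = (\<i> * of_real t) ^ n / fact n * of_real (enn2real (\<integral>\<^sup>+ x. ennreal (x ^ n) \<partial>L))" .
    qed
    finally show ?thesis .
  qed
  show "char M t = char N t"
    using char_series[OF M assms(3)] char_series[OF N assms(4)] eq by simp
qed

text \<open>The two variables may live on different spaces: later the channel power on
  \<open>M\<close> is compared with the identity on a density over the real line.\<close>

lemma distr_eqI_laplace:
  fixes X :: "'a \<Rightarrow> real" and Y :: "'b \<Rightarrow> real"
  assumes "prob_space M" "prob_space N"
    and [measurable]: "X \<in> borel_measurable M" "Y \<in> borel_measurable N"
    and nonneg: "AE x in M. 0 \<le> X x" "AE y in N. 0 \<le> Y y"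
    and laplace: "\<And>n :: nat. (\<integral>\<^sup>+ x. exp (- (n * X x)) \<partial>M) = (\<integral>\<^sup>+ y. exp (- (n * Y y)) \<partial>N)"
  shows "distr M borel X = distr N borel Y"
proof -
  interpret M: prob_space M by fact
  interpret N: prob_space N by fact
  let ?X = "distr M borel (\<lambda>x. exp (- X x))" and ?Y = "distr N borel (\<lambda>y. exp (- Y y))"
  have "?X = ?Y"
  proof (rule real_distribution_eqI_moments)
    show "AE x in ?X. 0 \<le> x \<and> x \<le> 1"
      using nonneg(1) by (subst AE_distr_iff) (auto elim!: eventually_mono)
    show "AE x in ?Y. 0 \<le> x \<and> x \<le> 1"
      using nonneg(2) by (subst AE_distr_iff) (auto elim!: eventually_mono)
    show "(\<integral>\<^sup>+ x. ennreal (x ^ n) \<partial>?X) = (\<integral>\<^sup>+ x. ennreal (x ^ n) \<partial>?Y)" for n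
      using laplace[of n] by (simp add: nn_integral_distr exp_of_nat_mult[symmetric])
  qed (auto intro!: M.real_distribution_distr N.real_distribution_distr)
  \<comment> \<open>The map \<open>u \<mapsto> - ln u\<close> undoes
    \<open>x \<mapsto> exp (- x)\<close> and carries the equality back to the original laws.\<close>
  then have "distr ?X borel (\<lambda>u. - ln u) = distr ?Y borel (\<lambda>u. - ln u)"
    by simp
  then show ?thesis
    by (simp add: distr_distr o_def)
qed

section \<open>Gaussian integrals and integrating out one independent variable\<close>

text \<open>The density with variance \<open>1 / 2\<close> is
  \<open>exp (- x\<^sup>2) / sqrt pi\<close>. Completing the square in the total exponent leaves a
  constant times a normal density of variance \<open>1 / (2 * d)\<close> with
  \<open>d = 1 + s * r\<^sup>2\<close>, which integrates to one.\<close>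

lemma nn_integral_exp_square_normal:
  fixes m s :: real
  assumes "0 \<le> s"
  shows "(\<integral>\<^sup>+ x. ennreal (normal_density 0 (sqrt (1 / 2)) x) * ennreal (exp (- (s * (m + r * x)\<^sup>2))) \<partial>lborel)
    = ennreal (exp (- (s * m\<^sup>2 / (1 + s * r\<^sup>2))) / sqrt (1 + s * r\<^sup>2))"
proof -
  define d where "d = 1 + s * r\<^sup>2"
  have d: "0 < d" using assms by (simp add: d_def add_pos_nonneg)
  let ?c = "exp (- (s * m\<^sup>2 / d)) / sqrt d" and ?\<mu> = "- s * r * m / d" and ?\<sigma> = "sqrt (1 / (2 * d))"
  have square: "- (s * (m + r * x)\<^sup>2) - x\<^sup>2 = - (s * m\<^sup>2 / d) - d * (x - ?\<mu>)\<^sup>2" for x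
  proof -
    \<comment> \<open>After multiplication by \<open>d\<close> the square is completed by a
      polynomial identity, without fractions.\<close>
    have "d * (- (s * (m + r * x)\<^sup>2) - x\<^sup>2) = - (s * m\<^sup>2) - (d * x + s * r * m)\<^sup>2"
      unfolding d_def by algebra
    also have "(d * x + s * r * m)\<^sup>2 = d * (d * (x - ?\<mu>)\<^sup>2)"
      using d by (simp add: field_simps power2_eq_square)
    finally have "- (s * (m + r * x)\<^sup>2) - x\<^sup>2 = (- (s * m\<^sup>2) - d * (d * (x - ?\<mu>)\<^sup>2)) / d"
      using d by (simp add: field_simps)
    then show ?thesis
      using d by (simp add: diff_divide_distrib)
  qed
  have "normal_density 0 (sqrt (1 / 2)) x * exp (- (s * (m + r * x)\<^sup>2)) = ?c * normal_density ?\<mu> ?\<sigma> x" for x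
  proof -
    have "normal_density 0 (sqrt (1 / 2)) x * exp (- (s * (m + r * x)\<^sup>2))
        = 1 / sqrt pi * exp (- (s * (m + r * x)\<^sup>2) - x\<^sup>2)"
      by (simp add: normal_density_def exp_diff exp_minus field_simps)
    also have "\<dots> = 1 / sqrt pi * exp (- (s * m\<^sup>2 / d) - d * (x - ?\<mu>)\<^sup>2)"
      unfolding square ..
    also have "\<dots> = ?c * normal_density ?\<mu> ?\<sigma> x"
    proof -
      \<comment> \<open>The identity holds for every constant \<open>k\<close> and every centre
        \<open>\<mu>\<close>; abstracting them keeps their own fractions out of the
        calculation.\<close>
      have "1 / sqrt pi * exp (- k - d * (x - \<mu>)\<^sup>2) = exp (- k) / sqrt d * normal_density \<mu> ?\<sigma> x" for k \<mu>
        using d by (simp add: normal_density_def exp_diff exp_minus real_sqrt_divide real_sqrt_mult field_simps)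
      then show ?thesis .
    qed
    finally show ?thesis .
  qed
  then have "(\<integral>\<^sup>+ x. ennreal (normal_density 0 (sqrt (1 / 2)) x) * ennreal (exp (- (s * (m + r * x)\<^sup>2))) \<partial>lborel)
      = (\<integral>\<^sup>+ x. ennreal ?c * ennreal (normal_density ?\<mu> ?\<sigma> x) \<partial>lborel)"
    using d by (simp add: ennreal_mult[symmetric])
  also have "\<dots> = ennreal ?c * emeasure (density lborel (normal_density ?\<mu> ?\<sigma>)) (space lborel)"
    by (simp add: nn_integral_cmult emeasure_density)
  also have "emeasure (density lborel (normal_density ?\<mu> ?\<sigma>)) (space lborel) = 1"
    using prob_space.emeasure_space_1[OF prob_space_normal_density[of ?\<sigma> ?\<mu>]] d by simp
  finally show ?thesis
    by (simp add: d_def)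
qed

context prob_space begin

text \<open>Independence makes the joint law a product, to which Tonelli applies. Both integrals on
  the right run over \<open>M\<close> again, so that \<open>X\<close> is integrated out with
  \<open>Y\<close> frozen at the sample point \<open>v\<close>, and the step can be
  iterated.\<close>

lemma nn_integral_indep_var:
  assumes "indep_var S X T Y" and F: "F \<in> borel_measurable (S \<Otimes>\<^sub>M T)"
  shows "(\<integral>\<^sup>+ w. F (X w, Y w) \<partial>M) = (\<integral>\<^sup>+ v. \<integral>\<^sup>+ w. F (X w, Y v) \<partial>M \<partial>M)"
proof -
  have X[measurable]: "X \<in> measurable M S" and Y[measurable]: "Y \<in> measurable M T"
    and prod: "distr M S X \<Otimes>\<^sub>M distr M T Y = distr M (S \<Otimes>\<^sub>M T) (\<lambda>w. (X w, Y w))"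
    using assms(1) unfolding indep_var_distribution_eq by auto
  interpret S: prob_space "distr M S X" by (rule prob_space_distr) fact
  interpret T: prob_space "distr M T Y" by (rule prob_space_distr) fact
  interpret ST: pair_sigma_finite "distr M S X" "distr M T Y" ..
  note F[measurable]
  have "(\<integral>\<^sup>+ w. F (X w, Y w) \<partial>M) = (\<integral>\<^sup>+ p. F p \<partial>distr M (S \<Otimes>\<^sub>M T) (\<lambda>w. (X w, Y w)))"
    by (simp add: nn_integral_distr)
  also have "\<dots> = (\<integral>\<^sup>+ y. \<integral>\<^sup>+ x. F (x, y) \<partial>distr M S X \<partial>distr M T Y)"
    unfolding prod[symmetric] by (rule ST.nn_integral_snd[symmetric]) measurable
  also have "\<dots> = (\<integral>\<^sup>+ v. \<integral>\<^sup>+ x. F (x, Y v) \<partial>distr M S X \<partial>M)"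
    by (subst nn_integral_distr) simp_all
  also have "\<dots> = (\<integral>\<^sup>+ v. \<integral>\<^sup>+ w. F (X w, Y v) \<partial>M \<partial>M)"
  proof (intro nn_integral_cong)
    fix v assume "v \<in> space M"
    then have [simp]: "Y v \<in> space T" by (rule measurable_space[OF Y])
    show "(\<integral>\<^sup>+ x. F (x, Y v) \<partial>distr M S X) = (\<integral>\<^sup>+ w. F (X w, Y v) \<partial>M)"
      by (subst nn_integral_distr) simp_all
  qed
  finally show ?thesis .
qed

lemma std_complex_normal_measurable:
  assumes "std_complex_normal G"
  shows "G \<in> borel_measurable M"
proof -
  have "(\<lambda>w. Re (G w)) \<in> borel_measurable M" "(\<lambda>w. Im (G w)) \<in> borel_measurable M"
    using assms unfolding std_complex_normal_def by (auto dest: distributed_measurable)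
  then show ?thesis
    by (simp add: borel_measurable_complex_iff)
qed

text \<open>Real and imaginary part each contribute a factor
  \<open>1 / sqrt (1 + s * (cmod c)\<^sup>2)\<close>, so the square roots multiply away and the
  exponents add up to \<open>(cmod m)\<^sup>2\<close>. The offset \<open>m\<close> and the
  coefficient \<open>c\<close> stand for whatever is frozen while \<open>G\<close> is integrated
  out.\<close>

lemma std_complex_normal_laplace:
  assumes G: "std_complex_normal G" and s: "0 \<le> s"
  shows "(\<integral>\<^sup>+ w. exp (- (s * (cmod (m + c * G w))\<^sup>2)) \<partial>M)
    = ennreal (exp (- (s * (cmod m)\<^sup>2 / (1 + s * (cmod c)\<^sup>2))) / (1 + s * (cmod c)\<^sup>2))"
proof -
  define r where "r = cmod c"
  obtain m' where m': "cmod m' = cmod m" "\<And>z. cmod (m + c * z) = cmod (m' + of_real r * z)"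
  proof (cases "c = 0")
    case True
    then show ?thesis using that[of m] by (simp add: r_def)
  next
    case False
    \<comment> \<open>A rotation makes the factor real, so that real and imaginary parts separate.\<close>
    define u where "u = cnj c / of_real r"
    have u: "cmod u = 1" "u * c = of_real r"
      using False by (simp_all add: u_def r_def norm_divide complex_norm_square[symmetric] power2_eq_square mult.commute[of "cnj c"])
    show ?thesis
    proof (rule that[of "u * m"])
      fix z
      have "cmod (m + c * z) = cmod (u * (m + c * z))" by (simp add: norm_mult u)
      also have "u * (m + c * z) = u * m + of_real r * z" by (simp add: u(2)[symmetric] algebra_simps)
      finally show "cmod (m + c * z) = cmod (u * m + of_real r * z)" .
    qed (simp add: norm_mult u)
  qed
  let ?E = "\<lambda>m x. ennreal (exp (- (s * (m + r * x)\<^sup>2)))"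
  define d where "d = 1 + s * r\<^sup>2"
  have d: "0 < d" using s by (simp add: d_def add_pos_nonneg)
  have indep: "indep_var borel (\<lambda>w. Re (G w)) borel (\<lambda>w. Im (G w))"
    and Re: "distributed M lborel (\<lambda>w. Re (G w)) (normal_density 0 (sqrt (1 / 2)))"
    and Im: "distributed M lborel (\<lambda>w. Im (G w)) (normal_density 0 (sqrt (1 / 2)))"
    using G unfolding std_complex_normal_def by auto
  have marginal: "(\<integral>\<^sup>+ w. ?E a (X w) \<partial>M) = ennreal (exp (- (s * a\<^sup>2 / d)) / sqrt d)"
    if "distributed M lborel X (normal_density 0 (sqrt (1 / 2)))" for X a
    using distributed_nn_integral[OF that, of "?E a"] nn_integral_exp_square_normal[OF s, of a r]
    by (simp add: d_def)
  have [measurable]: "(\<lambda>w. Re (G w)) \<in> borel_measurable M" "(\<lambda>w. Im (G w)) \<in> borel_measurable M"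
    using distributed_measurable[OF Re] distributed_measurable[OF Im] by simp_all
  have "(\<integral>\<^sup>+ w. exp (- (s * (cmod (m + c * G w))\<^sup>2)) \<partial>M)
      = (\<integral>\<^sup>+ w. ?E (Re m') (Re (G w)) * ?E (Im m') (Im (G w)) \<partial>M)"
    unfolding m'(2) by (intro nn_integral_cong)
      (simp add: ennreal_mult[symmetric] exp_add[symmetric] cmod_power2 algebra_simps)
  also have "\<dots> = (\<integral>\<^sup>+ v. \<integral>\<^sup>+ w. ?E (Re m') (Re (G w)) * ?E (Im m') (Im (G v)) \<partial>M \<partial>M)"
    using nn_integral_indep_var[OF indep, of "\<lambda>(x, y). ?E (Re m') x * ?E (Im m') y"] by simp
  also have "\<dots> = ennreal (exp (- (s * (Re m')\<^sup>2 / d)) / sqrt d) * ennreal (exp (- (s * (Im m')\<^sup>2 / d)) / sqrt d)"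
    by (simp add: nn_integral_multc nn_integral_cmult marginal[OF Re] marginal[OF Im])
  also have "\<dots> = ennreal (exp (- (s * (cmod m')\<^sup>2 / d)) / d)"
    using d by (simp add: ennreal_mult[symmetric] cmod_power2 exp_add[symmetric] algebra_simps add_divide_distrib)
  finally show ?thesis
    by (simp add: m'(1) d_def r_def)
qed

end

section \<open>Rician and exponential laws through their Laplace transforms\<close>

lemma bessel_I0_measurable[measurable]: "bessel_I0 \<in> borel_measurable borel"
  unfolding bessel_I0_def[abs_def] by measurable

lemma rice_snr_pdf_measurable[measurable (raw)]:
  assumes [measurable]: "k \<in> borel_measurable N" "g \<in> borel_measurable N" "h \<in> borel_measurable N"
  shows "(\<lambda>x. rice_snr_pdf (k x) (g x) (h x)) \<in> borel_measurable N"
  unfolding rice_snr_pdf_def by measurable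

lemma cond_snr_measurable[measurable]: "cond_snr g \<alpha> \<in> borel_measurable borel"
  unfolding cond_snr_def[abs_def] by measurable

lemma cond_K_measurable[measurable]: "cond_K \<alpha> \<beta> \<in> borel_measurable borel"
  unfolding cond_K_def[abs_def] by measurable

text \<open>With \<open>l = (1 + K) / g\<close> the Bessel argument is \<open>2 * sqrt z\<close> for
  \<open>z = K * l * y\<close>. Its term \<open>z ^ k / (fact k)\<^sup>2\<close> splits into the
  Poisson weight \<open>K ^ k / fact k\<close> and the factor \<open>(l * y) ^ k / fact k\<close> of
  the Erlang density.\<close>

lemma rice_snr_pdf_sums_erlang:
  assumes "0 \<le> K" "0 < g"
  shows "(\<lambda>k. exp (- K) * K ^ k / fact k * erlang_density k ((1 + K) / g) y) sums rice_snr_pdf K g y"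
proof (cases "0 \<le> y")
  case True
  define l z where "l = (1 + K) / g" and "z = K * (1 + K) * y / g"
  have z: "0 \<le> z" using assms True by (simp add: z_def)
  have term_eq: "(2 * sqrt z / 2) ^ (2 * k) / (fact k)\<^sup>2 = z ^ k / (fact k)\<^sup>2" for k
    using z by (simp add: power_mult)
  \<comment> \<open>Since \<open>bessel_I0\<close> is a bare infinite sum, convergence must be
    supplied; the exponential series dominates.\<close>
  have "summable (\<lambda>k. z ^ k / (fact k)\<^sup>2 :: real)"
  proof (rule summable_comparison_test'[where N = 0])
    show "summable (\<lambda>k. z ^ k / fact k)"
      using summable_exp[of z] by (simp add: divide_inverse mult.commute)
    show "norm (z ^ k / (fact k)\<^sup>2) \<le> z ^ k / fact k" for k
      using z by (auto simp: power2_eq_square intro!: divide_left_mono mult_pos_pos)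
  qed
  then have "(\<lambda>k. z ^ k / (fact k)\<^sup>2) sums bessel_I0 (2 * sqrt z)"
    unfolding bessel_I0_def term_eq by (rule summable_sums)
  then have "(\<lambda>k. l * exp (- K) * exp (- (l * y)) * (z ^ k / (fact k)\<^sup>2))
      sums (l * exp (- K) * exp (- (l * y)) * bessel_I0 (2 * sqrt z))"
    by (rule sums_mult)
  also have "(\<lambda>k. l * exp (- K) * exp (- (l * y)) * (z ^ k / (fact k)\<^sup>2))
      = (\<lambda>k. exp (- K) * K ^ k / fact k * erlang_density k l y)"
  proof
    fix k
    have "z = K * l * y" by (simp add: z_def l_def)
    then show "l * exp (- K) * exp (- (l * y)) * (z ^ k / (fact k)\<^sup>2)
        = exp (- K) * K ^ k / fact k * erlang_density k l y"
      using True by (simp add: erlang_density_def power_mult_distrib power2_eq_square)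
  qed
  also have "l * exp (- K) * exp (- (l * y)) * bessel_I0 (2 * sqrt z) = rice_snr_pdf K g y"
    using True by (simp add: rice_snr_pdf_def l_def z_def)
  finally show ?thesis by (simp add: l_def)
qed (simp add: rice_snr_pdf_def erlang_density_def)

lemma rice_snr_pdf_nonneg:
  assumes "0 \<le> K" "0 < g"
  shows "0 \<le> rice_snr_pdf K g y"
  by (rule sums_le[OF _ sums_zero rice_snr_pdf_sums_erlang[OF assms]]) (use assms in simp)

text \<open>Tilting by \<open>exp (- (s * y))\<close> turns the Erlang density of rate
  \<open>l\<close> into a multiple of the one of rate \<open>l + s\<close>, which has mass one. The
  exponent is \<open>Suc k\<close> because \<open>erlang_density k\<close> is the law of a sum of
  \<open>k + 1\<close> exponentials.\<close>

lemma nn_integral_exp_erlang: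
  assumes "0 < l" "0 \<le> s"
  shows "(\<integral>\<^sup>+ y. ennreal (exp (- (s * y))) * ennreal (erlang_density k l y) \<partial>lborel)
    = ennreal ((l / (l + s)) ^ Suc k)"
proof -
  have "exp (- (s * y)) * erlang_density k l y = (l / (l + s)) ^ Suc k * erlang_density k (l + s) y" for y
    using assms by (simp add: erlang_density_def power_divide exp_diff exp_minus exp_add field_simps del: power_Suc)
  then have "(\<integral>\<^sup>+ y. ennreal (exp (- (s * y))) * ennreal (erlang_density k l y) \<partial>lborel)
      = (\<integral>\<^sup>+ y. ennreal ((l / (l + s)) ^ Suc k) * ennreal (erlang_density k (l + s) y) \<partial>lborel)"
    using assms by (simp add: ennreal_mult[symmetric] del: power_Suc)
  also have "\<dots> = ennreal ((l / (l + s)) ^ Suc k) * emeasure (density lborel (erlang_density k (l + s))) (space lborel)"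
    by (simp add: nn_integral_cmult emeasure_density del: power_Suc)
  also have "emeasure (density lborel (erlang_density k (l + s))) (space lborel) = 1"
    using prob_space.emeasure_space_1[OF prob_space_erlang_density[of "l + s" k]] assms by simp
  finally show ?thesis by simp
qed

text \<open>The Erlang terms contribute \<open>q ^ Suc k\<close> with
  \<open>q = l / (l + s)\<close>, so the Poisson weights sum to
  \<open>q * exp (- (K * (1 - q)))\<close>. The closing steps express \<open>q\<close> through
  \<open>K\<close> and \<open>g\<close>.\<close>

lemma nn_integral_exp_rice:
  assumes K: "0 \<le> K" and g: "0 < g" and s: "0 \<le> s"
  shows "(\<integral>\<^sup>+ y. ennreal (exp (- (s * y))) * ennreal (rice_snr_pdf K g y) \<partial>lborel)
    = ennreal ((1 + K) / (1 + K + s * g) * exp (- (K * (s * g) / (1 + K + s * g))))"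
proof -
  define l q where "l = (1 + K) / g" and "q = l / (l + s)"
  have l: "0 < l" and q: "0 < q" using assms by (simp_all add: l_def q_def divide_pos_pos add_pos_nonneg)
  let ?e = "\<lambda>k y. exp (- K) * K ^ k / fact k * erlang_density k l y"
  have e_nonneg: "0 \<le> ?e k y" for k y using K l by simp
  have rice: "ennreal (rice_snr_pdf K g y) = (\<Sum>k. ennreal (?e k y))" for y
    using rice_snr_pdf_sums_erlang[OF K g, of y] e_nonneg unfolding l_def[symmetric]
    by (intro suminf_ennreal_eq[symmetric]) auto
  have poisson: "(\<lambda>k. exp (- K) * K ^ k / fact k * q ^ Suc k) sums (q * exp (- K) * exp (K * q))"
  proof -
    have "(\<lambda>k. (K * q) ^ k / fact k) sums exp (K * q)"
      using exp_converges[of "K * q"] by (simp add: divide_inverse mult.commute)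
    from sums_mult[OF this, of "q * exp (- K)"] show ?thesis
      by (simp add: power_mult_distrib mult_ac)
  qed
  have "(\<integral>\<^sup>+ y. ennreal (exp (- (s * y))) * ennreal (rice_snr_pdf K g y) \<partial>lborel)
      = (\<integral>\<^sup>+ y. (\<Sum>k. ennreal (exp (- K) * K ^ k / fact k) * (ennreal (exp (- (s * y))) * ennreal (erlang_density k l y))) \<partial>lborel)"
    unfolding rice ennreal_suminf_cmult[symmetric]
    using K l by (intro nn_integral_cong suminf_cong) (simp add: ennreal_mult[symmetric] mult_ac)
  also have "\<dots> = (\<Sum>k. ennreal (exp (- K) * K ^ k / fact k) * ennreal (q ^ Suc k))"
    by (subst nn_integral_suminf) (auto simp: nn_integral_cmult nn_integral_exp_erlang[OF l s] q_def simp del: power_Suc)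
  also have "\<dots> = (\<Sum>k. ennreal (exp (- K) * K ^ k / fact k * q ^ Suc k))"
    using K q by (intro suminf_cong) (simp add: ennreal_mult[symmetric] del: power_Suc)
  also have "\<dots> = ennreal (q * exp (- K) * exp (K * q))"
    using K q poisson by (intro suminf_ennreal_eq) (auto simp del: power_Suc)
  also have "q * exp (- K) * exp (K * q) = q * exp (- (K * (1 - q)))"
    by (simp add: exp_add[symmetric] algebra_simps)
  also have "q = (1 + K) / (1 + K + s * g)"
  proof -
    have "q = (l * g) / ((l + s) * g)" using g by (simp add: q_def)
    moreover have "l * g = 1 + K" using g by (simp add: l_def)
    ultimately show ?thesis by (simp add: distrib_right)
  qed
  also have "1 - (1 + K) / (1 + K + s * g) = s * g / (1 + K + s * g)"
  proof -
    have "1 + K + s * g \<noteq> 0" using K g s by (smt (verit) mult_nonneg_nonneg)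
    then show ?thesis by (simp add: field_simps)
  qed
  finally show ?thesis by simp
qed

text \<open>Both laws have Laplace transform \<open>1 / (1 + n)\<close>: on one side the Gaussian
  formula with offset 0 and coefficient 1, on the other the Erlang formula with \<open>k = 0\<close>
  and rate 1.\<close>

lemma (in prob_space) std_complex_normal_power_exponential:
  assumes G: "std_complex_normal G"
  shows "distributed M lborel (\<lambda>w. (cmod (G w))\<^sup>2) (exponential_density 1)"
proof -
  have G_meas[measurable]: "G \<in> borel_measurable M"
    using G by (rule std_complex_normal_measurable)
  let ?N = "density lborel (exponential_density 1)"
  have "distr M borel (\<lambda>w. (cmod (G w))\<^sup>2) = distr ?N borel (\<lambda>x. x)"
  proof (rule distr_eqI_laplace)
    show "prob_space ?N" by (rule prob_space_exponential_density) simp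
    show "AE x in ?N. 0 \<le> x"
      by (subst AE_density) (auto simp: erlang_density_def)
    fix n :: nat
    have "(\<integral>\<^sup>+ x. exp (- (n * x)) \<partial>?N) = ennreal (1 / (1 + real n))"
      using nn_integral_exp_erlang[of 1 "real n" 0]
      by (subst nn_integral_density) (simp_all add: mult.commute)
    then show "(\<integral>\<^sup>+ w. exp (- (n * (cmod (G w))\<^sup>2)) \<partial>M) = (\<integral>\<^sup>+ x. exp (- (n * x)) \<partial>?N)"
      using std_complex_normal_laplace[OF G, of "real n" 0 1] by simp
  qed (use prob_space_axioms in simp_all)
  also have "distr ?N borel (\<lambda>x. x) = ?N"
    by (rule distr_id2) simp
  finally have "distr M lborel (\<lambda>w. (cmod (G w))\<^sup>2) = ?N"
    by (simp cong: distr_cong)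
  then show ?thesis
    by (simp add: distributed_def)
qed

section \<open>Laplace transform of the power of the SOSF signal\<close>

context sosf_channel begin

abbreviation scatter_var :: "real \<Rightarrow> real" where
  "scatter_var x \<equiv> \<omega>1\<^sup>2 + \<omega>2\<^sup>2 * x"

lemma measurable_components[measurable]:
  "\<phi> \<in> borel_measurable M" "G1 \<in> borel_measurable M" "G2 \<in> borel_measurable M" "G3 \<in> borel_measurable M"
  using distributed_measurable[OF phase_uniform] complex_normal
  by (auto intro: std_complex_normal_measurable)

lemma sosf_signal_measurable[measurable]: "sosf_signal \<phi> G1 G2 G3 \<omega>0 \<omega>1 \<omega>2 \<in> borel_measurable M"
  unfolding sosf_signal_def[abs_def] by measurable

abbreviation component :: "nat \<Rightarrow> 'a \<Rightarrow> complex" where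
  "component \<equiv> (\<lambda>i. [\<lambda>w. complex_of_real (\<phi> w), G1, G2, G3] ! i)"

text \<open>While \<open>G1\<close> is integrated out, all other variables enter through a single
  complex offset, so their tuple is collapsed to that number.\<close>

lemma indep_G1:
  "indep_var borel G1 borel (\<lambda>w. of_real \<omega>0 * exp (\<i> * of_real (\<phi> w)) + of_real \<omega>2 * G2 w * G3 w)"
proof -
  have "indep_var (PiM {1} (\<lambda>_. borel)) (\<lambda>w. \<lambda>i\<in>{1}. component i w)
      (PiM {0, 2, 3} (\<lambda>_. borel)) (\<lambda>w. \<lambda>i\<in>{0, 2, 3}. component i w)"
    by (rule indep_var_restrict[OF mutually_indep]) auto
  from indep_var_compose[OF this, of "\<lambda>f. f 1" borel
      "\<lambda>f. of_real \<omega>0 * exp (\<i> * f 0) + of_real \<omega>2 * f 2 * f 3" borel]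
  show ?thesis
    by (simp add: o_def numeral_2_eq_2 numeral_3_eq_3)
qed

text \<open>Here the tuples are kept: phase and \<open>G3\<close> enter the next integration
  separately, one in the offset and the other in the coefficient of \<open>G2\<close>.\<close>

lemma indep_G2:
  "indep_var (PiM {2} (\<lambda>_. borel)) (\<lambda>w. \<lambda>i\<in>{2}. component i w)
    (PiM {0, 3} (\<lambda>_. borel)) (\<lambda>w. \<lambda>i\<in>{0, 3}. component i w)"
  by (rule indep_var_restrict[OF mutually_indep]) auto

lemma sosf_laplace:
  assumes s: "0 \<le> s"
  shows "(\<integral>\<^sup>+ w. exp (- (s * (cmod (sosf_signal \<phi> G1 G2 G3 \<omega>0 \<omega>1 \<omega>2 w))\<^sup>2)) \<partial>M)
    = (\<integral>\<^sup>+ x. ennreal (exponential_density 1 x) *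
        ennreal (exp (- (s * \<omega>0\<^sup>2 / (1 + s * scatter_var x))) / (1 + s * scatter_var x)) \<partial>lborel)"
proof -
  let ?e = "\<lambda>w. of_real \<omega>0 * exp (\<i> * of_real (\<phi> w))"
  let ?U = "\<lambda>w. ?e w + of_real \<omega>2 * G2 w * G3 w"
  \<comment> \<open>Integrating out \<open>G1\<close> yields the factor \<open>1 / d\<close> and an
    integral of the same kind with \<open>s\<close> replaced by \<open>t\<close>.\<close>
  define d t where "d = 1 + s * \<omega>1\<^sup>2" and "t = s / d"
  have d: "0 < d" using s by (simp add: d_def add_pos_nonneg)
  have t: "0 \<le> t" using s d by (simp add: t_def)
  have cmod_e[simp]: "cmod (?e w) = \<omega>0" for w
    using weights_nonneg by (simp add: norm_mult)
  have [simp]: "cmod (of_real \<omega>1) = \<omega>1"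
    using weights_nonneg by simp
  have "(\<integral>\<^sup>+ w. exp (- (s * (cmod (sosf_signal \<phi> G1 G2 G3 \<omega>0 \<omega>1 \<omega>2 w))\<^sup>2)) \<partial>M)
      = (\<integral>\<^sup>+ w. ennreal (exp (- (s * (cmod (?U w + of_real \<omega>1 * G1 w))\<^sup>2))) \<partial>M)"
    by (simp add: sosf_signal_def add_ac)
  also have "\<dots> = (\<integral>\<^sup>+ v. \<integral>\<^sup>+ w. exp (- (s * (cmod (?U v + of_real \<omega>1 * G1 w))\<^sup>2)) \<partial>M \<partial>M)"
    using nn_integral_indep_var[OF indep_G1, of "\<lambda>(g, u). exp (- (s * (cmod (u + of_real \<omega>1 * g))\<^sup>2))"]
    by simp
  also have "\<dots> = (\<integral>\<^sup>+ w. ennreal (1 / d) * ennreal (exp (- (t * (cmod (?U w))\<^sup>2))) \<partial>M)"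
    using d by (simp add: std_complex_normal_laplace[OF complex_normal(1) s] d_def[symmetric] t_def
        ennreal_mult[symmetric])
  also have "\<dots> = ennreal (1 / d) * (\<integral>\<^sup>+ w. ennreal (exp (- (t * (cmod (?e w + of_real \<omega>2 * G3 w * G2 w))\<^sup>2))) \<partial>M)"
    by (simp add: nn_integral_cmult mult_ac)
  also have "(\<integral>\<^sup>+ w. ennreal (exp (- (t * (cmod (?e w + of_real \<omega>2 * G3 w * G2 w))\<^sup>2))) \<partial>M)
      = (\<integral>\<^sup>+ v. \<integral>\<^sup>+ w. exp (- (t * (cmod (?e v + of_real \<omega>2 * G3 v * G2 w))\<^sup>2)) \<partial>M \<partial>M)"
    using nn_integral_indep_var[OF indep_G2, of "\<lambda>(g, h). exp (- (t * (cmod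
        (of_real \<omega>0 * exp (\<i> * h 0) + of_real \<omega>2 * h 3 * g 2))\<^sup>2))"]
    by (simp add: numeral_2_eq_2 numeral_3_eq_3)
  \<comment> \<open>The phase disappears with \<open>G2\<close>: the Gaussian formula sees only the
    modulus \<open>\<omega>0\<close> of the offset. What is left depends on \<open>G3\<close>
    through its squared modulus.\<close>
  also have "\<dots> = (\<integral>\<^sup>+ w. ennreal (exp (- (t * \<omega>0\<^sup>2 / (1 + t * (\<omega>2\<^sup>2 * (cmod (G3 w))\<^sup>2))))
      / (1 + t * (\<omega>2\<^sup>2 * (cmod (G3 w))\<^sup>2))) \<partial>M)"
    by (simp only: std_complex_normal_laplace[OF complex_normal(2) t] cmod_e)
       (simp add: norm_mult power_mult_distrib)
  also have "\<dots> = (\<integral>\<^sup>+ x. ennreal (exponential_density 1 x) *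
      ennreal (exp (- (t * \<omega>0\<^sup>2 / (1 + t * (\<omega>2\<^sup>2 * x)))) / (1 + t * (\<omega>2\<^sup>2 * x))) \<partial>lborel)"
    by (rule distributed_nn_integral[OF std_complex_normal_power_exponential[OF complex_normal(3)], symmetric])
       measurable
  also have "ennreal (1 / d) * \<dots> = (\<integral>\<^sup>+ x. ennreal (exponential_density 1 x) *
      ennreal (exp (- (s * \<omega>0\<^sup>2 / (1 + s * scatter_var x))) / (1 + s * scatter_var x)) \<partial>lborel)"
  proof (subst nn_integral_cmult[symmetric], measurable, intro nn_integral_cong)
    fix x :: real
    show "ennreal (1 / d) * (ennreal (exponential_density 1 x) *
        ennreal (exp (- (t * \<omega>0\<^sup>2 / (1 + t * (\<omega>2\<^sup>2 * x)))) / (1 + t * (\<omega>2\<^sup>2 * x))))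
      = ennreal (exponential_density 1 x) *
        ennreal (exp (- (s * \<omega>0\<^sup>2 / (1 + s * scatter_var x))) / (1 + s * scatter_var x))"
    \<comment> \<open>For negative \<open>x\<close> the denominators may fail to be positive, but
      the exponential density vanishes there. For the others, the factors of the two integrations
      combine as \<open>d * c\<close>.\<close>
    proof (cases "0 \<le> x")
      case True
      define c where "c = 1 + t * (\<omega>2\<^sup>2 * x)"
      have "0 < c" using True t by (simp add: c_def add_pos_nonneg)
      moreover have dc: "1 + s * scatter_var x = d * c"
      proof -
        have "d * c = d + d * t * (\<omega>2\<^sup>2 * x)" by (simp add: c_def algebra_simps)
        also have "d * t = s" using d by (simp add: t_def)
        finally show ?thesis by (simp add: d_def algebra_simps)
      qed
      moreover have "t * \<omega>0\<^sup>2 / c = s * \<omega>0\<^sup>2 / (d * c)" by (simp add: t_def)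
      ultimately show ?thesis
        using d unfolding c_def[symmetric] by (simp add: ennreal_mult[symmetric] mult_ac)
    qed (simp add: erlang_density_def)
  qed
  finally show ?thesis .
qed

section \<open>The exponential mixture of Rician densities as density of the SNR\<close>

text \<open>Values in \<open>ennreal\<close> allow Tonelli without integrability. The point 0 is
  left out because the denominator of \<open>cond_K\<close> is \<open>\<omega>1\<^sup>2\<close>
  there, which may be zero.\<close>

definition rice_mixture :: "real \<Rightarrow> real \<Rightarrow> ennreal" where
  "rice_mixture \<gamma>bar y =
    (\<integral>\<^sup>+ x \<in> {0<..}. ennreal (rice_snr_pdf (cond_K (\<omega>2\<^sup>2) (\<omega>0\<^sup>2) x) (cond_snr \<gamma>bar (\<omega>2\<^sup>2) x) y)
       * ennreal (exp (- x)) \<partial>lborel)"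

lemma rice_mixture_measurable[measurable]: "rice_mixture \<gamma>bar \<in> borel_measurable borel"
  unfolding rice_mixture_def[abs_def] by measurable

lemma scatter_var_pos:
  assumes "\<omega>0\<^sup>2 < 1" "0 < x"
  shows "0 < scatter_var x"
proof (cases "\<omega>2 = 0")
  case True
  then have "scatter_var x = 1 - \<omega>0\<^sup>2" using weights_normalized by simp
  then show ?thesis using assms by simp
next
  case False
  then show ?thesis using assms by (intro add_nonneg_pos) auto
qed

text \<open>Given the squared modulus \<open>x\<close> of \<open>G3\<close>, the terms with
  \<open>G1\<close> and \<open>G2\<close> form one complex Gaussian of variance
  \<open>scatter_var x\<close>. Hence the Rician factor is the ratio of direct to scattered power
  and the mean SNR is proportional to their sum; the normalization of the weights gives these
  forms.\<close>

lemma cond_K_eq: "cond_K (\<omega>2\<^sup>2) (\<omega>0\<^sup>2) x = \<omega>0\<^sup>2 / scatter_var x"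
  and cond_snr_eq: "cond_snr \<gamma>bar (\<omega>2\<^sup>2) x = \<gamma>bar * (\<omega>0\<^sup>2 + scatter_var x)"
proof -
  have eq: "1 - \<omega>0\<^sup>2 = \<omega>1\<^sup>2 + \<omega>2\<^sup>2" "1 = \<omega>0\<^sup>2 + \<omega>1\<^sup>2 + \<omega>2\<^sup>2"
    using weights_normalized by simp_all
  show "cond_K (\<omega>2\<^sup>2) (\<omega>0\<^sup>2) x = \<omega>0\<^sup>2 / scatter_var x"
    unfolding cond_K_def eq(1) by (simp add: algebra_simps)
  have "1 - \<omega>2\<^sup>2 * (1 - x) = \<omega>0\<^sup>2 + scatter_var x"
    using eq(2) by (simp add: algebra_simps)
  then show "cond_snr \<gamma>bar (\<omega>2\<^sup>2) x = \<gamma>bar * (\<omega>0\<^sup>2 + scatter_var x)"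
    by (simp add: cond_snr_def)
qed

lemma rice_nonneg:
  assumes "0 < \<gamma>bar" "\<omega>0\<^sup>2 < 1" "0 < x"
  shows "0 \<le> rice_snr_pdf (cond_K (\<omega>2\<^sup>2) (\<omega>0\<^sup>2) x) (cond_snr \<gamma>bar (\<omega>2\<^sup>2) x) y"
  using scatter_var_pos[OF assms(2,3)] assms
  by (intro rice_snr_pdf_nonneg) (auto simp: cond_K_eq cond_snr_eq intro!: mult_pos_pos add_nonneg_pos)

text \<open>The Rician transform takes the shape of the integrand in \<open>sosf_laplace\<close>,
  with \<open>s * \<gamma>bar\<close> in place of \<open>s\<close>.\<close>

lemma nn_integral_exp_cond_rice:
  assumes g: "0 < \<gamma>bar" and "\<omega>0\<^sup>2 < 1" "0 < x" and s: "0 \<le> s"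
  shows "(\<integral>\<^sup>+ y. ennreal (exp (- (s * y))) *
      ennreal (rice_snr_pdf (cond_K (\<omega>2\<^sup>2) (\<omega>0\<^sup>2) x) (cond_snr \<gamma>bar (\<omega>2\<^sup>2) x) y) \<partial>lborel)
    = ennreal (exp (- (s * \<gamma>bar * \<omega>0\<^sup>2 / (1 + s * \<gamma>bar * scatter_var x))) / (1 + s * \<gamma>bar * scatter_var x))"
proof -
  define b v where "b = \<omega>0\<^sup>2" and "v = scatter_var x"
  have v: "0 < v" and b: "0 \<le> b"
    using scatter_var_pos[OF assms(2,3)] by (simp_all add: v_def b_def)
  define D where "D = 1 + s * \<gamma>bar * v"
  have D: "0 < D" using v g s by (simp add: D_def add_pos_nonneg)
  have K1: "1 + b / v = (b + v) / v" using v by (simp add: field_simps)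
  \<comment> \<open>The factor \<open>(b + v) / v\<close> found here also appears in both numerators
    below and cancels.\<close>
  have KD: "1 + b / v + s * (\<gamma>bar * (b + v)) = (b + v) / v * D"
    using v by (simp add: D_def field_simps)
  have "(\<integral>\<^sup>+ y. ennreal (exp (- (s * y))) * ennreal (rice_snr_pdf (b / v) (\<gamma>bar * (b + v)) y) \<partial>lborel)
    = ennreal ((1 + b / v) / (1 + b / v + s * (\<gamma>bar * (b + v))) *
        exp (- (b / v * (s * (\<gamma>bar * (b + v))) / (1 + b / v + s * (\<gamma>bar * (b + v))))))"
    using b v g s by (intro nn_integral_exp_rice) auto
  also have "(1 + b / v) / (1 + b / v + s * (\<gamma>bar * (b + v))) = 1 / D"
    unfolding KD using b v D by (simp add: K1)
  also have "b / v * (s * (\<gamma>bar * (b + v))) / (1 + b / v + s * (\<gamma>bar * (b + v))) = s * \<gamma>bar * b / D"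
  proof -
    have "b / v * (s * (\<gamma>bar * (b + v))) = (b + v) / v * (s * \<gamma>bar * b)" by simp
    moreover have "(b + v) / v \<noteq> 0" using b v by simp
    ultimately show ?thesis unfolding KD by (metis nonzero_mult_divide_mult_cancel_left)
  qed
  finally show ?thesis
    unfolding cond_K_eq cond_snr_eq unfolding b_def[symmetric] v_def[symmetric] D_def[symmetric] by simp
qed

lemma rice_mixture_laplace:
  assumes g: "0 < \<gamma>bar" and \<omega>0: "\<omega>0\<^sup>2 < 1" and s: "0 \<le> s"
  shows "(\<integral>\<^sup>+ y. rice_mixture \<gamma>bar y * ennreal (exp (- (s * y))) \<partial>lborel)
    = (\<integral>\<^sup>+ w. exp (- (s * (\<gamma>bar * (cmod (sosf_signal \<phi> G1 G2 G3 \<omega>0 \<omega>1 \<omega>2 w))\<^sup>2))) \<partial>M)"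
proof -
  let ?r = "\<lambda>x y. ennreal (rice_snr_pdf (cond_K (\<omega>2\<^sup>2) (\<omega>0\<^sup>2) x) (cond_snr \<gamma>bar (\<omega>2\<^sup>2) x) y)"
  have "(\<integral>\<^sup>+ y. rice_mixture \<gamma>bar y * ennreal (exp (- (s * y))) \<partial>lborel)
      = (\<integral>\<^sup>+ y. \<integral>\<^sup>+ x. ?r x y * ennreal (exp (- x)) * indicator {0<..} x * ennreal (exp (- (s * y))) \<partial>lborel \<partial>lborel)"
    unfolding rice_mixture_def by (subst nn_integral_multc[symmetric]) simp_all
  also have "\<dots> = (\<integral>\<^sup>+ x. \<integral>\<^sup>+ y. ?r x y * ennreal (exp (- x)) * indicator {0<..} x * ennreal (exp (- (s * y))) \<partial>lborel \<partial>lborel)"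
    by (rule lborel_pair.Fubini') measurable
  also have "\<dots> = (\<integral>\<^sup>+ x. ennreal (exp (- x)) * indicator {0<..} x * (\<integral>\<^sup>+ y. ennreal (exp (- (s * y))) * ?r x y \<partial>lborel) \<partial>lborel)"
    by (subst nn_integral_cmult[symmetric]) (simp_all add: mult_ac)
  also have "\<dots> = (\<integral>\<^sup>+ x. ennreal (exponential_density 1 x) *
        ennreal (exp (- (s * \<gamma>bar * \<omega>0\<^sup>2 / (1 + s * \<gamma>bar * scatter_var x))) / (1 + s * \<gamma>bar * scatter_var x)) \<partial>lborel)"
  \<comment> \<open>At \<open>x = 0\<close> the integrands differ: the indicator of the open
    half-line is 0, whereas the exponential density is 1. That point is a null set.\<close>
  proof (rule nn_integral_cong_AE, rule AE_mp[OF AE_lborel_singleton[of 0]], intro AE_I2 impI)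
    fix x :: real assume "x \<noteq> 0"
    then consider "x < 0" | "0 < x" by linarith
    then show "ennreal (exp (- x)) * indicator {0<..} x * (\<integral>\<^sup>+ y. ennreal (exp (- (s * y))) * ?r x y \<partial>lborel)
      = ennreal (exponential_density 1 x) *
        ennreal (exp (- (s * \<gamma>bar * \<omega>0\<^sup>2 / (1 + s * \<gamma>bar * scatter_var x))) / (1 + s * \<gamma>bar * scatter_var x))"
      by cases (simp_all add: erlang_density_def nn_integral_exp_cond_rice[OF g \<omega>0 _ s])
  qed
  also have "\<dots> = (\<integral>\<^sup>+ w. exp (- (s * \<gamma>bar * (cmod (sosf_signal \<phi> G1 G2 G3 \<omega>0 \<omega>1 \<omega>2 w))\<^sup>2)) \<partial>M)"
    using s g by (intro sosf_laplace[symmetric]) simp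
  finally show ?thesis by (simp add: mult.assoc)
qed

lemma sosf_snr_distr:
  assumes g: "0 < \<gamma>bar" and \<omega>0: "\<omega>0\<^sup>2 < 1"
  shows "distr M borel (\<lambda>w. \<gamma>bar * (cmod (sosf_signal \<phi> G1 G2 G3 \<omega>0 \<omega>1 \<omega>2 w))\<^sup>2)
    = density lborel (rice_mixture \<gamma>bar)"
proof -
  let ?N = "density lborel (rice_mixture \<gamma>bar)"
  let ?Y = "\<lambda>w. \<gamma>bar * (cmod (sosf_signal \<phi> G1 G2 G3 \<omega>0 \<omega>1 \<omega>2 w))\<^sup>2"
  have "distr M borel ?Y = distr ?N borel (\<lambda>x. x)"
  proof (rule distr_eqI_laplace)
    show "prob_space M" by (rule prob_space_axioms)
    \<comment> \<open>The Laplace transform at 0 is the total mass.\<close>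
    show "prob_space ?N"
      using rice_mixture_laplace[OF g \<omega>0, of 0] emeasure_space_1
      by (intro prob_spaceI) (simp add: emeasure_density)
    have "rice_mixture \<gamma>bar y = 0" if "y < 0" for y
      using that by (simp add: rice_mixture_def rice_snr_pdf_def)
    then show "AE y in ?N. 0 \<le> y"
      by (subst AE_density) (auto simp: not_le[symmetric] intro!: AE_I2)
    show "(\<integral>\<^sup>+ w. exp (- (n * ?Y w)) \<partial>M) = (\<integral>\<^sup>+ y. exp (- (n * y)) \<partial>?N)" for n :: nat
      by (simp add: nn_integral_density rice_mixture_laplace[OF g \<omega>0])
  qed (use g in simp_all)
  then show ?thesis by (simp add: distr_id2)
qed

end

section \<open>Interchanging the metric average with the mixture\<close>

text \<open>For an arbitrary nonnegative kernel \<open>r\<close>, the first claim is Tonelli.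
  Applied to the absolute value of the metric, the same exchange shows that the joint integrand is
  integrable, which gives the signed claim by Fubini.\<close>

lemma
  fixes r :: "real \<Rightarrow> real \<Rightarrow> real" and f H :: "real \<Rightarrow> real"
  assumes r[measurable]: "(\<lambda>(x, y). r x y) \<in> borel_measurable (borel \<Otimes>\<^sub>M borel)"
    and r_nonneg: "\<And>x y. 0 < x \<Longrightarrow> 0 \<le> r x y"
    and f_nonneg: "\<And>y. 0 \<le> f y"
    and mixture: "AE y in lborel. ennreal (f y) = (\<integral>\<^sup>+ x \<in> {0<..}. ennreal (r x y) * ennreal (exp (- x)) \<partial>lborel)"
    and ab: "a < b"
    and H: "set_borel_measurable lborel (einterval a b) H"
  shows nn_avg_metric_mixture: "(\<And>y. y \<in> einterval a b \<Longrightarrow> 0 \<le> H y) \<Longrightarrow>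
      nn_avg_metric H a b f = (\<integral>\<^sup>+ x \<in> {0<..}. nn_avg_metric H a b (r x) * ennreal (exp (- x)) \<partial>lborel)"
    and avg_metric_mixture: "interval_lebesgue_integrable lborel a b (\<lambda>y. H y * f y) \<Longrightarrow>
      (AE x in lborel. 0 < x \<longrightarrow> interval_lebesgue_integrable lborel a b (\<lambda>y. H y * r x y)) \<and>
      interval_lebesgue_integrable lborel 0 \<infinity> (\<lambda>x. avg_metric H a b (r x) * exp (- x)) \<and>
      avg_metric H a b f = (LBINT x=0..\<infinity>. avg_metric H a b (r x) * exp (- x))"
proof -
  have le: "a \<le> b" using ab by (rule less_imp_le)
  define h where "h y = indicator (einterval a b) y * H y" for y
  have h[measurable]: "h \<in> borel_measurable borel"
    using H by (simp add: set_borel_measurable_def h_def[abs_def])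
  \<comment> \<open>The weight \<open>k\<close> will be \<open>h\<close> for the nonnegative claim
    and the absolute value of \<open>h\<close> for integrability.\<close>
  have nn_mixture: "(\<integral>\<^sup>+ y. ennreal (k y) * ennreal (f y) \<partial>lborel)
      = (\<integral>\<^sup>+ x \<in> {0<..}. (\<integral>\<^sup>+ y. ennreal (k y) * ennreal (r x y) \<partial>lborel) * ennreal (exp (- x)) \<partial>lborel)"
    if [measurable]: "k \<in> borel_measurable borel" for k :: "real \<Rightarrow> real"
  proof -
    have "(\<integral>\<^sup>+ y. ennreal (k y) * ennreal (f y) \<partial>lborel)
        = (\<integral>\<^sup>+ y. ennreal (k y) * (\<integral>\<^sup>+ x \<in> {0<..}. ennreal (r x y) * ennreal (exp (- x)) \<partial>lborel) \<partial>lborel)"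
      using mixture by (intro nn_integral_cong_AE) auto
    also have "\<dots> = (\<integral>\<^sup>+ y. \<integral>\<^sup>+ x. ennreal (k y) * (ennreal (r x y) * ennreal (exp (- x)) * indicator {0<..} x) \<partial>lborel \<partial>lborel)"
      by (subst nn_integral_cmult) simp_all
    also have "\<dots> = (\<integral>\<^sup>+ x. \<integral>\<^sup>+ y. ennreal (k y) * (ennreal (r x y) * ennreal (exp (- x)) * indicator {0<..} x) \<partial>lborel \<partial>lborel)"
      by (rule lborel_pair.Fubini') measurable
    also have "\<dots> = (\<integral>\<^sup>+ x \<in> {0<..}. (\<integral>\<^sup>+ y. ennreal (k y) * ennreal (r x y) \<partial>lborel) * ennreal (exp (- x)) \<partial>lborel)"
      by (simp add: nn_integral_multc[symmetric] mult.assoc)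
    finally show ?thesis .
  qed
  have zero_interval: "einterval 0 \<infinity> = {0<..}"
    using einterval_eq_Ici[of 0] by (simp add: zero_ereal_def)
  {
    assume H_nonneg: "\<And>y. y \<in> einterval a b \<Longrightarrow> 0 \<le> H y"
    have nn_avg: "nn_avg_metric H a b p = (\<integral>\<^sup>+ y. ennreal (h y) * ennreal (p y) \<partial>lborel)" if "\<And>y. 0 \<le> p y" for p
      unfolding nn_avg_metric_def using H_nonneg that
      by (intro nn_integral_cong) (simp add: h_def ennreal_mult[symmetric] split: split_indicator)
    show "nn_avg_metric H a b f = (\<integral>\<^sup>+ x \<in> {0<..}. nn_avg_metric H a b (r x) * ennreal (exp (- x)) \<partial>lborel)"
      unfolding nn_avg[OF f_nonneg] nn_mixture[OF h]
      by (intro nn_integral_cong) (simp add: nn_avg r_nonneg split: split_indicator)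
  }
  {
    assume "interval_lebesgue_integrable lborel a b (\<lambda>y. H y * f y)"
    then have int_hf: "integrable lborel (\<lambda>y. h y * f y)"
      using le by (simp add: interval_lebesgue_integrable_def set_integrable_def h_def mult.assoc)
    have avg: "avg_metric H a b p = (\<integral>y. h y * p y \<partial>lborel)" for p
      using le by (simp add: avg_metric_def interval_lebesgue_integral_def set_lebesgue_integral_def h_def mult.assoc)
    \<comment> \<open>Integrating \<open>F\<close> over \<open>y\<close> gives the weighted
      Rician-side average at \<open>x\<close>; integrating it over \<open>x\<close> gives
      \<open>h y * f y\<close> for almost every \<open>y\<close>.\<close>
    define F where "F x y = indicator {0<..} x * exp (- x) * (h y * r x y)" for x y :: real
    have F[measurable]: "(\<lambda>(x, y). F x y) \<in> borel_measurable (borel \<Otimes>\<^sub>M borel)"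
      unfolding F_def by measurable
    have "integrable (lborel \<Otimes>\<^sub>M lborel) (\<lambda>(x, y). F x y)"
    proof (rule integrableI_bounded)
      have "(\<integral>\<^sup>+ p. ennreal (norm (case p of (x, y) \<Rightarrow> F x y)) \<partial>(lborel \<Otimes>\<^sub>M lborel))
          = (\<integral>\<^sup>+ x. \<integral>\<^sup>+ y. ennreal (norm (F x y)) \<partial>lborel \<partial>lborel)"
        by (subst lborel.nn_integral_fst[symmetric]) simp_all
      also have "\<dots> = (\<integral>\<^sup>+ x \<in> {0<..}. (\<integral>\<^sup>+ y. ennreal \<bar>h y\<bar> * ennreal (r x y) \<partial>lborel) * ennreal (exp (- x)) \<partial>lborel)"
      proof (intro nn_integral_cong)
        fix x :: real
        have "ennreal (norm (F x y)) = ennreal \<bar>h y\<bar> * ennreal (r x y) * (ennreal (exp (- x)) * indicator {0<..} x)" for y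
          by (simp add: F_def abs_mult r_nonneg ennreal_mult[symmetric] mult_ac split: split_indicator)
        then show "(\<integral>\<^sup>+ y. ennreal (norm (F x y)) \<partial>lborel)
            = (\<integral>\<^sup>+ y. ennreal \<bar>h y\<bar> * ennreal (r x y) \<partial>lborel) * ennreal (exp (- x)) * indicator {0<..} x"
          by (simp only:) (subst nn_integral_multc, simp_all add: mult.assoc)
      qed
      \<comment> \<open>Read backwards, the mixture identity reduces integrability on the plane to
        the assumed integrability of \<open>h y * f y\<close>.\<close>
      also have "\<dots> = (\<integral>\<^sup>+ y. ennreal \<bar>h y\<bar> * ennreal (f y) \<partial>lborel)"
        by (rule nn_mixture[symmetric]) measurable
      also have "\<dots> = (\<integral>\<^sup>+ y. ennreal (norm (h y * f y)) \<partial>lborel)"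
        by (simp add: abs_mult f_nonneg ennreal_mult)
      also have "\<dots> < \<infinity>"
        using int_hf by (simp add: integrable_iff_bounded)
      finally show "(\<integral>\<^sup>+ p. ennreal (norm (case p of (x, y) \<Rightarrow> F x y)) \<partial>(lborel \<Otimes>\<^sub>M lborel)) < \<infinity>" .
    qed measurable
    note Fubini = lborel_pair.AE_integrable_fst[OF this] lborel_pair.integrable_fst[OF this]
      lborel_pair.Fubini_integral[OF this]
    have int_F: "(\<integral>y. F x y \<partial>lborel) = indicator {0<..} x * (avg_metric H a b (r x) * exp (- x))" for x
      unfolding F_def avg integral_mult_right_zero by simp
    have "AE x in lborel. 0 < x \<longrightarrow> interval_lebesgue_integrable lborel a b (\<lambda>y. H y * r x y)"
      using Fubini(1)
    proof eventually_elim
      case (elim x)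
      then show ?case
        using le by (auto simp: F_def interval_lebesgue_integrable_def set_integrable_def h_def mult.assoc)
    qed
    moreover have "interval_lebesgue_integrable lborel 0 \<infinity> (\<lambda>x. avg_metric H a b (r x) * exp (- x))"
      using Fubini(2) by (simp add: int_F interval_lebesgue_integrable_def set_integrable_def zero_interval)
    moreover have "avg_metric H a b f = (LBINT x=0..\<infinity>. avg_metric H a b (r x) * exp (- x))"
    proof -
      have "avg_metric H a b f = (\<integral>y. (\<integral>x. F x y \<partial>lborel) \<partial>lborel)"
        unfolding avg
      proof (rule integral_cong_AE)
        show "AE y in lborel. h y * f y = (\<integral>x. F x y \<partial>lborel)"
          using mixture
        proof eventually_elim
          case (elim y)
          \<comment> \<open>The mixture identity concerns nonnegative integrals. As
            \<open>?w\<close> is nonnegative, its Lebesgue integral is the real value of that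
            integral, namely \<open>f y\<close>.\<close>
          let ?w = "\<lambda>x. indicator {0<..} x * exp (- x) * r x y"
          have "(\<integral>x. ?w x \<partial>lborel) = enn2real (\<integral>\<^sup>+ x. ennreal (?w x) \<partial>lborel)"
            by (rule integral_eq_nn_integral) (auto simp: r_nonneg split: split_indicator)
          also have "(\<integral>\<^sup>+ x. ennreal (?w x) \<partial>lborel) = ennreal (f y)"
            unfolding elim
            by (intro nn_integral_cong) (simp add: r_nonneg ennreal_mult[symmetric] mult.commute split: split_indicator)
          finally have "(\<integral>x. ?w x \<partial>lborel) = f y"
            by (simp add: f_nonneg)
          moreover have "F x y = h y * ?w x" for x
            by (simp add: F_def mult_ac)
          ultimately show ?case by simp
        qed
      qed (use int_hf in simp_all)
      also have "\<dots> = (\<integral>x. (\<integral>y. F x y \<partial>lborel) \<partial>lborel)"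
        by (rule Fubini(3))
      finally show ?thesis
        by (simp add: int_F interval_lebesgue_integral_def set_lebesgue_integral_def zero_interval)
    qed
    ultimately show "(AE x in lborel. 0 < x \<longrightarrow> interval_lebesgue_integrable lborel a b (\<lambda>y. H y * r x y)) \<and>
      interval_lebesgue_integrable lborel 0 \<infinity> (\<lambda>x. avg_metric H a b (r x) * exp (- x)) \<and>
      avg_metric H a b f = (LBINT x=0..\<infinity>. avg_metric H a b (r x) * exp (- x))"
      by blast
  }
qed

section \<open>The averaged metric of the SOSF channel\<close>

theorem lemma1:
  fixes M :: "'a measure"
    and \<phi> :: "'a \<Rightarrow> real" and G1 G2 G3 :: "'a \<Rightarrow> complex"
    and \<omega>0 \<omega>1 \<omega>2 \<alpha> \<beta> \<gamma>bar :: real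
    and a b :: ereal
    and H f :: "real \<Rightarrow> real"
  assumes channel: "sosf_channel M \<phi> G1 G2 G3 \<omega>0 \<omega>1 \<omega>2"
    and \<alpha>: "\<alpha> = \<omega>2\<^sup>2" and \<beta>: "\<beta> = \<omega>0\<^sup>2"
    and \<gamma>bar: "0 < \<gamma>bar"
    and pdf: "distributed M lborel
                (\<lambda>w. \<gamma>bar * (cmod (sosf_signal \<phi> G1 G2 G3 \<omega>0 \<omega>1 \<omega>2 w))\<^sup>2) f"
    and pdf_nonneg: "\<And>y. 0 \<le> f y"
    and interval: "0 \<le> a" "a < b"
    and H: "set_borel_measurable lborel (einterval a b) H"
  shows "(interval_lebesgue_integrable lborel a b (\<lambda>y. H y * f y) \<longrightarrow>
            (AE x in lborel. 0 < x \<longrightarrow>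
               interval_lebesgue_integrable lborel a b
                 (\<lambda>y. H y * rice_snr_pdf (cond_K \<alpha> \<beta> x) (cond_snr \<gamma>bar \<alpha> x) y)) \<and>
            interval_lebesgue_integrable lborel 0 \<infinity>
              (\<lambda>x. avg_metric H a b (rice_snr_pdf (cond_K \<alpha> \<beta> x) (cond_snr \<gamma>bar \<alpha> x)) * exp (- x)) \<and>
            avg_metric H a b f =
              (LBINT x=0..\<infinity>.
                 avg_metric H a b (rice_snr_pdf (cond_K \<alpha> \<beta> x) (cond_snr \<gamma>bar \<alpha> x)) * exp (- x)))
       \<and> ((\<forall>y\<in>einterval a b. 0 \<le> H y) \<longrightarrow>
            nn_avg_metric H a b f =
              (\<integral>\<^sup>+ x \<in> einterval 0 \<infinity>.
                 nn_avg_metric H a b (rice_snr_pdf (cond_K \<alpha> \<beta> x) (cond_snr \<gamma>bar \<alpha> x)) * ennreal (exp (- x))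
               \<partial>lborel))"
proof -
  interpret sosf_channel M \<phi> G1 G2 G3 \<omega>0 \<omega>1 \<omega>2 by (rule channel)
  let ?Y = "\<lambda>w. \<gamma>bar * (cmod (sosf_signal \<phi> G1 G2 G3 \<omega>0 \<omega>1 \<omega>2 w))\<^sup>2"
  have law: "distr M lborel ?Y = density lborel f" and f[measurable]: "(\<lambda>y. ennreal (f y)) \<in> borel_measurable borel"
    using pdf by (auto simp: distributed_def)
  \<comment> \<open>For \<open>\<beta> = 1\<close> the SNR is constant, hence has no density.\<close>
  have \<omega>0: "\<omega>0\<^sup>2 < 1"
  proof (rule ccontr)
    assume "\<not> \<omega>0\<^sup>2 < 1"
    then have zero: "\<omega>0\<^sup>2 = 1" "\<omega>1 = 0" "\<omega>2 = 0"
      using weights_normalized zero_le_power2[of \<omega>1] zero_le_power2[of \<omega>2]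
      by (smt (verit) power_eq_0_iff)+
    have Y: "?Y = (\<lambda>_. \<gamma>bar)"
      using zero by (simp add: fun_eq_iff sosf_signal_def norm_mult power_mult_distrib)
    have "emeasure (distr M lborel ?Y) {\<gamma>bar} = 1"
      unfolding Y using emeasure_space_1 by (subst emeasure_distr) auto
    moreover have "emeasure (density lborel f) {\<gamma>bar} = 0"
    proof -
      have "AE y in lborel. ennreal (f y) * indicator {\<gamma>bar} y = 0"
        using AE_lborel_singleton[of \<gamma>bar] by eventually_elim simp
      then show ?thesis
        by (simp add: emeasure_density nn_integral_0_iff_AE)
    qed
    ultimately show False by (simp add: law)
  qed
  let ?r = "\<lambda>x. rice_snr_pdf (cond_K \<alpha> \<beta> x) (cond_snr \<gamma>bar \<alpha> x)"
  \<comment> \<open>Both functions are densities of the law of the SNR, so they agree up to a null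
    set, which is all that the exchange of integrals requires.\<close>
  have "density lborel f = density lborel (rice_mixture \<gamma>bar)"
    unfolding law[symmetric] sosf_snr_distr[OF \<gamma>bar \<omega>0, symmetric] by (rule distr_cong) simp_all
  then have "AE y in lborel. ennreal (f y) = rice_mixture \<gamma>bar y"
    by (intro sigma_finite_measure.density_unique[OF lborel.sigma_finite_measure_axioms]) simp_all
  then have mixture: "AE y in lborel. ennreal (f y) = (\<integral>\<^sup>+ x \<in> {0<..}. ennreal (?r x y) * ennreal (exp (- x)) \<partial>lborel)"
    by (simp add: rice_mixture_def \<alpha> \<beta>)
  have r: "(\<lambda>(x, y). ?r x y) \<in> borel_measurable (borel \<Otimes>\<^sub>M borel)"
    by measurable
  have r_nonneg: "0 \<le> ?r x y" if "0 < x" for x y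
    using rice_nonneg[OF \<gamma>bar \<omega>0 that] by (simp add: \<alpha> \<beta>)
  have zero_interval: "einterval 0 \<infinity> = {0<..}"
    using einterval_eq_Ici[of 0] by (simp add: zero_ereal_def)
  show ?thesis
    using avg_metric_mixture[OF r r_nonneg pdf_nonneg mixture interval(2) H]
      nn_avg_metric_mixture[OF r r_nonneg pdf_nonneg mixture interval(2) H]
    unfolding zero_interval by blast
qed

end
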